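(* Let $n$ be a positive integer, let $\mathbb{F}$ be a field, and let $\mathcal{V}\subseteq\mathbb{F}^n$ be a finite subset of the affine space $\mathbb{F}^n$. Suppose that $|\mathcal{V}|\geq 4^n$. Then $$n<AC(\mathcal{V}).$$
   Context: For a finite set of points $\mathcal{V}\subseteq\mathbb{F}^n$ and $\mathbf{v}\in\mathcal{V}$, a finite set of affine hyperplanes $\{H_1,\ldots,H_m\}$ of $\mathbb{F}^n$ is an almost cover of $\mathcal{V}$ and $\mathbf{v}$ if the union $\bigcup_{j=1}^m H_j$ contains $\mathcal{V}\setminus\{\mathbf{v}\}$ but does not contain $\mathbf{v}$. $AC(\mathcal{V},\mathbf{v})$ denotes the minimum size (number of hyperplanes) of an almost cover of $\mathcal{V}$ and $\mathbf{v}$, and $AC(\mathcal{V}):=\max_{\mathbf{v}\in\mathcal{V}}AC(\mathcal{V},\mathbf{v})$. *)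

theory Defs
  imports "HOL-Analysis.Finite_Cartesian_Product"
begin

definition affine_hyperplane :: "('a::field ^ 'n) set \<Rightarrow> bool" where
  "affine_hyperplane H \<longleftrightarrow> (\<exists>a b. a \<noteq> 0 \<and> H = {x. (\<Sum>i\<in>UNIV. a $ i * x $ i) = b})"

definition almost_cover :: "('a::field ^ 'n) set \<Rightarrow> 'a ^ 'n \<Rightarrow> ('a ^ 'n) set set \<Rightarrow> bool" where
  "almost_cover V v \<H> \<longleftrightarrow>
     finite \<H> \<and> (\<forall>H\<in>\<H>. affine_hyperplane H) \<and> V - {v} \<subseteq> \<Union>\<H> \<and> v \<notin> \<Union>\<H>"

definition AC_point :: "('a::field ^ 'n) set \<Rightarrow> 'a ^ 'n \<Rightarrow> nat" where
  "AC_point V v = (LEAST m. \<exists>\<H>. almost_cover V v \<H> \<and> card \<H> = m)"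

definition AC :: "('a::field ^ 'n) set \<Rightarrow> nat" where
  "AC V = Max (AC_point V ` V)"

(* The LEAST in AC_point is a genuine minimum for every finite V. *)
lemma almost_cover_exists:
  fixes V :: "('a::field ^ 'n) set"
  assumes "finite V"
  shows "\<exists>\<H>. almost_cover V v \<H>"
proof -
  have "\<exists>H. affine_hyperplane H \<and> w \<in> H \<and> v \<notin> H" if "w \<noteq> v" for w :: "'a ^ 'n"
  proof -
    from that obtain k where k: "w $ k \<noteq> v $ k"
      by (auto simp: vec_eq_iff)
    define a :: "'a ^ 'n" where "a = axis k 1"
    have dot: "(\<Sum>i\<in>UNIV. a $ i * x $ i) = x $ k" for x :: "'a ^ 'n"
      by (simp add: a_def axis_def if_distrib[of "\<lambda>c. c * _"] cong: if_cong)
    have "a \<noteq> 0"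
      by (simp add: a_def axis_eq_0_iff)
    then have "affine_hyperplane {x. (\<Sum>i\<in>UNIV. a $ i * x $ i) = w $ k}"
      unfolding affine_hyperplane_def by blast
    with k show ?thesis
      by (intro exI[of _ "{x. (\<Sum>i\<in>UNIV. a $ i * x $ i) = w $ k}"]) (auto simp: dot)
  qed
  then obtain h where h: "\<And>w. w \<noteq> v \<Longrightarrow> affine_hyperplane (h w) \<and> w \<in> h w \<and> v \<notin> h w"
    by metis
  have "almost_cover V v (h ` (V - {v}))"
    using assms h unfolding almost_cover_def by auto
  then show ?thesis ..
qed

end

theory Submission
  imports Defs "HOL-Library.Function_Algebras" "HOL-Library.Multiset"
begin

text \<open>
  If every point \<open>v\<close> of \<open>V\<close> had an almost cover by at most \<open>n\<close> hyperplanes, the products \<open>P v\<close> of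
  their defining affine forms would be functions with \<open>P v w = 0\<close> for \<open>w \<noteq> v\<close> in \<open>V\<close> and
  \<open>P v v \<noteq> 0\<close>. They are linearly independent and lie in the span of the monomials of degree at most
  \<open>n\<close> in \<open>n\<close> variables, whence \<open>card V \<le> (2 * n choose n) < 4 ^ n\<close>. Adjoining the constant
  function \<open>1\<close> to the coordinates turns those monomials into products of exactly \<open>n\<close> factors, that is,
  into multisets of size \<open>n\<close> over \<open>n + 1\<close> symbols.
\<close>

lemma sum_fun_apply: "sum f A x = (\<Sum>i\<in>A. f i x)"
  by (induction A rule: infinite_finite_induct) auto

interpretation fun_space: vector_space "\<lambda>(c::'a::field) (f::'b \<Rightarrow> 'a) x. c * f x"
  by unfold_locales (auto simp: fun_eq_iff algebra_simps)

text \<open>Evaluating a vanishing linear combination of the functions \<open>F w\<close> at a point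
  \<open>v\<close> of \<open>V\<close> leaves only the term of \<open>F v\<close>, so its
  coefficient is 0. An independent family inside the span of \<open>T\<close> has at most
  \<open>card T\<close> members.\<close>

lemma card_le_of_separating_functions:
  fixes F :: "'b \<Rightarrow> 'b \<Rightarrow> 'a::field"
  assumes "finite V" and "finite T"
    and span: "\<And>v. v \<in> V \<Longrightarrow> F v \<in> fun_space.span T"
    and diag: "\<And>v. v \<in> V \<Longrightarrow> F v v \<noteq> 0"
    and off_diag: "\<And>v w. v \<in> V \<Longrightarrow> w \<in> V \<Longrightarrow> w \<noteq> v \<Longrightarrow> F v w = 0"
  shows "card V \<le> card T"
proof -
  have inj: "inj_on F V"
    by (rule inj_onI) (metis diag off_diag)
  have "fun_space.independent (F ` V)"
  proof (rule fun_space.independent_if_scalars_zero)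
    fix u f
    assume sum0: "(\<Sum>f\<in>F ` V. (\<lambda>x. u f * f x)) = 0" and "f \<in> F ` V"
    then obtain v where v: "v \<in> V" "f = F v"
      by blast
    have "0 = (\<Sum>f\<in>F ` V. (\<lambda>x. u f * f x)) v"
      by (simp add: sum0)
    also have "\<dots> = (\<Sum>w\<in>V. u (F w) * F w v)"
      by (simp add: sum_fun_apply sum.reindex[OF inj])
    also have "\<dots> = (\<Sum>w\<in>V. if w = v then u f * F v v else 0)"
      using v off_diag by (intro sum.cong) auto
    also have "\<dots> = u f * F v v"
      using v \<open>finite V\<close> by simp
    finally show "u f = 0"
      using diag v by simp
  qed (use \<open>finite V\<close> in simp)
  then have "card (F ` V) \<le> card T"
    using fun_space.independent_span_bound[OF \<open>finite T\<close>] span by blast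
  then show ?thesis
    by (simp add: card_image inj)
qed

definition monomial :: "('j \<Rightarrow> 'b \<Rightarrow> 'a::comm_monoid_mult) \<Rightarrow> 'j multiset \<Rightarrow> 'b \<Rightarrow> 'a" where
  "monomial g M x = (\<Prod>j\<in>#M. g j x)"

text \<open>Multiplication by \<open>g j\<close> is linear and sends the monomial of
  \<open>M\<close> to that of \<open>add_mset j M\<close>, so induction over the span reduces the
  claim to single monomials.\<close>

lemma mult_generator_in_span:
  fixes g :: "'j \<Rightarrow> 'b \<Rightarrow> 'a::field"
  assumes "f \<in> fun_space.span (monomial g ` multisets_of_size J k)" and "j \<in> J"
  shows "(\<lambda>x. g j x * f x) \<in> fun_space.span (monomial g ` multisets_of_size J (Suc k))"
  using assms(1)
proof (induction rule: fun_space.span_induct_alt)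
  case base
  show ?case
    using fun_space.span_zero by (simp add: zero_fun_def)
next
  case (step c m f)
  then obtain M where M: "M \<in> multisets_of_size J k" "m = monomial g M"
    by blast
  have "add_mset j M \<in> multisets_of_size J (Suc k)"
    using M \<open>j \<in> J\<close> by (auto simp: multisets_of_size_def)
  then have "monomial g (add_mset j M) \<in> fun_space.span (monomial g ` multisets_of_size J (Suc k))"
    by (blast intro: fun_space.span_base)
  from fun_space.span_add[OF fun_space.span_scale[OF this] step(2)]
  have "(\<lambda>x. c * monomial g (add_mset j M) x) + (\<lambda>x. g j x * f x)
      \<in> fun_space.span (monomial g ` multisets_of_size J (Suc k))" .
  moreover have "(\<lambda>x. c * monomial g (add_mset j M) x) + (\<lambda>x. g j x * f x)
      = (\<lambda>x. g j x * ((\<lambda>x. c * m x) + f) x)"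
    by (auto simp: M monomial_def fun_eq_iff algebra_simps)
  ultimately show ?case
    by simp
qed

text \<open>Expand one linear form at a time: each of its terms multiplies the remaining product by
  a scalar and one generator, which raises the degree by one.\<close>

lemma prod_linear_forms_in_span:
  fixes g :: "'j \<Rightarrow> 'b \<Rightarrow> 'a::field"
  assumes "finite I"
  shows "(\<lambda>x. \<Prod>i\<in>I. \<Sum>j\<in>J. c i j * g j x)
    \<in> fun_space.span (monomial g ` multisets_of_size J (card I))"
  using assms
proof (induction I rule: finite_induct)
  case empty
  show ?case
    by (auto intro!: fun_space.span_base simp: monomial_def)
next
  case (insert i I)
  define p where "p x = (\<Prod>i\<in>I. \<Sum>j\<in>J. c i j * g j x)" for x
  have "(\<Sum>j\<in>J. (\<lambda>x. c i j * (g j x * p x)))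
      \<in> fun_space.span (monomial g ` multisets_of_size J (Suc (card I)))"
    using insert.IH unfolding p_def
    by (intro fun_space.span_sum fun_space.span_scale mult_generator_in_span)
  moreover have "(\<lambda>x. \<Prod>i\<in>insert i I. \<Sum>j\<in>J. c i j * g j x)
      = (\<Sum>j\<in>J. (\<lambda>x. c i j * (g j x * p x)))"
    using insert.hyps by (simp add: fun_eq_iff sum_fun_apply p_def sum_distrib_right mult.assoc)
  ultimately show ?case
    using insert.hyps by simp
qed

text \<open>Padding a multiset with copies of the symbol \<open>j\<close> leaves its monomial
  unchanged, because \<open>g j\<close> is constantly 1.\<close>

lemma monomials_degree_mono:
  assumes "j \<in> J" and "g j = (\<lambda>_. 1)" and "k \<le> d"
  shows "monomial g ` multisets_of_size J k \<subseteq> monomial g ` multisets_of_size J d"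
proof
  fix m assume "m \<in> monomial g ` multisets_of_size J k"
  then obtain M where M: "M \<in> multisets_of_size J k" "m = monomial g M"
    by blast
  have "m = monomial g (M + replicate_mset (d - k) j)"
    using assms(2) by (simp add: M monomial_def fun_eq_iff)
  moreover have "M + replicate_mset (d - k) j \<in> multisets_of_size J d"
    using M assms by (auto simp: multisets_of_size_def split: if_splits)
  ultimately show "m \<in> monomial g ` multisets_of_size J d"
    by blast
qed

text \<open>The symbol \<open>None\<close> stands for the adjoined constant function, so that affine
  forms become linear forms in these coordinates.\<close>

definition homogeneous_coord :: "'n option \<Rightarrow> 'a::one ^ 'n \<Rightarrow> 'a" where
  "homogeneous_coord j x = (case j of None \<Rightarrow> 1 | Some i \<Rightarrow> x $ i)"

text \<open>The product of the affine forms of the hyperplanes vanishes exactly on the union of the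
  cover. Smaller covers also reach degree \<open>d\<close> by padding with the constant
  coordinate.\<close>

lemma almost_cover_separating_function:
  fixes V :: "('a::field ^ 'n) set"
  assumes cover: "almost_cover V v \<H>" and "card \<H> \<le> d"
  shows "\<exists>f \<in> fun_space.span (monomial homogeneous_coord ` multisets_of_size UNIV d).
    f v \<noteq> 0 \<and> (\<forall>w\<in>V. w \<noteq> v \<longrightarrow> f w = 0)"
proof -
  have "\<exists>a b. \<forall>x. x \<in> H \<longleftrightarrow> (\<Sum>i\<in>UNIV. a $ i * x $ i) = b" if "H \<in> \<H>" for H
  proof -
    have "affine_hyperplane H"
      using cover that by (simp add: almost_cover_def)
    then show ?thesis
      by (auto simp: affine_hyperplane_def)
  qed
  then obtain a b where H: "\<And>H x. H \<in> \<H> \<Longrightarrow> x \<in> H \<longleftrightarrow> (\<Sum>i\<in>UNIV. a H $ i * x $ i) = b H"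
    by metis
  \<comment> \<open>The right-hand side of the equation of \<open>H\<close> moves to the left as the
    coefficient of the constant coordinate.\<close>
  define c where "c H j = (case j of None \<Rightarrow> - b H | Some i \<Rightarrow> a H $ i)" for H j
  define form where "form H x = (\<Sum>j\<in>UNIV. c H j * homogeneous_coord j x)" for H and x :: "'a ^ 'n"
  have "form H x = (\<Sum>i\<in>UNIV. a H $ i * x $ i) - b H" for H x
    unfolding form_def UNIV_option_conv
    by (subst sum.insert) (simp_all add: sum.reindex c_def homogeneous_coord_def)
  then have form: "form H x = 0 \<longleftrightarrow> x \<in> H" if "H \<in> \<H>" for H x
    using H that by simp
  let ?f = "\<lambda>x. \<Prod>H\<in>\<H>. form H x"
  have "finite \<H>"
    using cover by (simp add: almost_cover_def)
  then have "?f \<in> fun_space.span (monomial homogeneous_coord ` multisets_of_size UNIV (card \<H>))"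
    unfolding form_def by (rule prod_linear_forms_in_span)
  moreover have "monomial homogeneous_coord ` multisets_of_size UNIV (card \<H>)
      \<subseteq> (monomial homogeneous_coord ` multisets_of_size UNIV d :: ('a ^ 'n \<Rightarrow> 'a) set)"
    using \<open>card \<H> \<le> d\<close>
    by (intro monomials_degree_mono[where j = None]) (auto simp: homogeneous_coord_def)
  ultimately have "?f \<in> fun_space.span (monomial homogeneous_coord ` multisets_of_size UNIV d)"
    using fun_space.span_mono by blast
  moreover have "?f v \<noteq> 0"
    using cover \<open>finite \<H>\<close> form by (auto simp: almost_cover_def)
  moreover have "?f w = 0" if "w \<in> V" "w \<noteq> v" for w
  proof -
    have "w \<in> \<Union>\<H>"
      using cover that unfolding almost_cover_def by (meson DiffI singletonD subsetD)
    then obtain H where "H \<in> \<H>" "w \<in> H" ..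
    then show ?thesis
      using \<open>finite \<H>\<close> form by auto
  qed
  ultimately show ?thesis
    by (intro bexI[of _ ?f]) auto
qed

lemma AC_point_attained:
  assumes "finite V"
  shows "\<exists>\<H>. almost_cover V v \<H> \<and> card \<H> = AC_point V v"
proof -
  obtain \<H> where "almost_cover V v \<H>"
    using almost_cover_exists[OF assms] ..
  then have "\<exists>\<H>'. almost_cover V v \<H>' \<and> card \<H>' = card \<H>"
    by (intro exI[of _ \<H>]) simp
  then show ?thesis
    unfolding AC_point_def by (rule LeastI)
qed

text \<open>Every point of \<open>V\<close> has an almost cover of size at most \<open>d\<close>,
  hence a separating function in the span of the degree-\<open>d\<close> monomials; it remains to
  count these.\<close>

theorem card_le_if_AC_le:
  fixes V :: "('a::field ^ 'n) set"
  assumes "finite V" and "AC V \<le> d"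
  shows "card V \<le> CARD('n) + d choose d"
proof -
  let ?J = "UNIV :: 'n option set"
  let ?T = "monomial homogeneous_coord ` multisets_of_size ?J d :: ('a ^ 'n \<Rightarrow> 'a) set"
  have "\<exists>f \<in> fun_space.span ?T. f v \<noteq> 0 \<and> (\<forall>w\<in>V. w \<noteq> v \<longrightarrow> f w = 0)" if "v \<in> V" for v
  proof -
    obtain \<H> where \<H>: "almost_cover V v \<H>" "card \<H> = AC_point V v"
      using AC_point_attained[OF \<open>finite V\<close>] by blast
    have "AC_point V v \<le> AC V"
      unfolding AC_def using \<open>finite V\<close> that by simp
    with \<H> \<open>AC V \<le> d\<close> show ?thesis
      by (intro almost_cover_separating_function) auto
  qed
  then have "\<forall>v\<in>V. \<exists>f. f \<in> fun_space.span ?T \<and> f v \<noteq> 0 \<and> (\<forall>w\<in>V. w \<noteq> v \<longrightarrow> f w = 0)"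
    by (simp add: Bex_def)
  from bchoice[OF this] obtain F where F: "\<forall>v\<in>V. F v \<in> fun_space.span ?T \<and> F v v \<noteq> 0 \<and>
      (\<forall>w\<in>V. w \<noteq> v \<longrightarrow> F v w = 0)" ..
  have fin: "finite (multisets_of_size ?J d)"
    by (rule finite_multisets_of_size) simp
  have "card V \<le> card ?T"
    by (rule card_le_of_separating_functions[of _ _ F]) (use F fin \<open>finite V\<close> in auto)
  also have "\<dots> \<le> card (multisets_of_size ?J d)"
    using fin by (rule card_image_le)
  \<comment> \<open>Stars and bars over \<open>CARD('n) + 1\<close> symbols: the upper index is
    \<open>(CARD('n) + 1) + d - 1\<close>.\<close>
  also have "\<dots> = CARD('n) + d choose d"
    by (simp add: card_multisets_of_size card_UNIV_option)
  finally show ?thesis .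
qed

text \<open>Row \<open>2 * n\<close> of Pascal's triangle sums to \<open>4 ^ n\<close>. For positive
  \<open>n\<close> its entry 1 at position 0 is distinct from the central one, which makes the
  inequality strict.\<close>

lemma central_binomial_less_four_power:
  assumes "n > 0"
  shows "(n + n choose n) < 4 ^ n"
proof -
  have "(\<Sum>k\<in>{0, n}. n + n choose k) \<le> (\<Sum>k\<le>n + n. n + n choose k)"
    by (intro sum_mono2) auto
  also have "\<dots> = 4 ^ n"
    by (simp add: choose_row_sum power_add flip: power_mult_distrib)
  finally show ?thesis
    using assms by simp
qed

theorem corollary1p6:
  fixes V :: "('a::field ^ 'n) set"
  assumes "finite V"
    and "card V \<ge> 4 ^ CARD('n)"
  shows "CARD('n) < AC V"
proof (rule ccontr)
  assume "\<not> CARD('n) < AC V"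
  then have "card V \<le> CARD('n) + CARD('n) choose CARD('n)"
    using card_le_if_AC_le[OF \<open>finite V\<close>] by simp
  then show False
    using central_binomial_less_four_power[of "CARD('n)"] assms(2) by simp
qed

end
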